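(* Let $n\ge3$ be an integer and $m\ge3$ an odd integer, and consider the problem of maximizing $f(\mathbf u)=\sum_{i=1}^n u_i^m$ over $\mathbf u\in\mathbb R^n$ subject to $\mathbf u^{\mathrm T}\mathbf u=1$ and $\mathbf u^{\mathrm T}\mathbf 1_n=0$. Let $1\le k\le\lfloor n/2\rfloor$ and consider the stationary points $\mathbf u=\mathbf P[a\mathbf 1_k^{\mathrm T},\,b\mathbf 1_{n-k}^{\mathrm T}]^{\mathrm T}$, where $\mathbf P$ is an $n\times n$ permutation matrix, $a=\sqrt{\frac{n-k}{kn}}$ and $b=-\sqrt{\frac{k}{(n-k)n}}$. Then: (i) when $k=1$, these points are local maximum points of the problem; (ii) when $2\le k\le\lfloor n/2\rfloor$, these points are saddle points of the problem.
   Context: $\mathbf 1_k$ denotes the all-ones column vector of length $k$. A stationary point of the problem is a real $\mathbf u$ satisfying both constraints for which there exist real Lagrange multipliers $\alpha,\beta$ with $u_i^{m-1}-\alpha u_i-\beta=0$ for all $i$. Local maximum (minimum) points are understood relative to the feasible set $\{\mathbf u:\mathbf u^{\mathrm T}\mathbf u=1,\ \mathbf u^{\mathrm T}\mathbf 1_n=0\}$; a saddle point is a stationary point that is neither a local maximum nor a local minimum of $f$ on the feasible set. *)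

theory Defs
  imports "HOL-Analysis.Analysis"
begin

definition objective :: "nat \<Rightarrow> real^'n \<Rightarrow> real" where
  "objective m u = (\<Sum>i\<in>UNIV. (u $ i) ^ m)"

definition feasible_set :: "(real^'n) set" where
  "feasible_set = {u. u \<bullet> u = 1 \<and> u \<bullet> vec 1 = 0}"

definition stationary_point :: "nat \<Rightarrow> real^'n \<Rightarrow> bool" where
  "stationary_point m u \<longleftrightarrow> u \<in> feasible_set \<and>
     (\<exists>\<alpha> \<beta>. \<forall>i. (u $ i) ^ (m - 1) - \<alpha> * u $ i - \<beta> = 0)"

definition local_max_on :: "'a::metric_space set \<Rightarrow> ('a \<Rightarrow> real) \<Rightarrow> 'a \<Rightarrow> bool" where
  "local_max_on S f u \<longleftrightarrow> u \<in> S \<and> (\<exists>\<epsilon>>0. \<forall>v\<in>S. dist v u < \<epsilon> \<longrightarrow> f v \<le> f u)"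

definition local_min_on :: "'a::metric_space set \<Rightarrow> ('a \<Rightarrow> real) \<Rightarrow> 'a \<Rightarrow> bool" where
  "local_min_on S f u \<longleftrightarrow> u \<in> S \<and> (\<exists>\<epsilon>>0. \<forall>v\<in>S. dist v u < \<epsilon> \<longrightarrow> f u \<le> f v)"

definition saddle_point :: "nat \<Rightarrow> real^'n \<Rightarrow> bool" where
  "saddle_point m u \<longleftrightarrow> stationary_point m u \<and>
     \<not> local_max_on feasible_set (objective m) u \<and>
     \<not> local_min_on feasible_set (objective m) u"

definition permutation_matrix :: "real^'n^'n \<Rightarrow> bool" where
  "permutation_matrix P \<longleftrightarrow>
     (\<exists>p. p permutes UNIV \<and> P = (\<chi> i j. if j = p i then 1 else 0))"

(* The index type carries no order, so the numbering e of the coordinates by 1..n is explicit: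
   entry e j of block_vec e k a b is the j-th entry of (a, ..., a, b, ..., b) with k copies of a. *)
definition block_vec :: "(nat \<Rightarrow> 'n) \<Rightarrow> nat \<Rightarrow> real \<Rightarrow> real \<Rightarrow> real^'n" where
  "block_vec e k a b = (\<chi> i. if i \<in> e ` {1..k} then a else b)"

end

theory Submission
  imports Defs
begin

text \<open>
  The points in question take only two values, \<open>a > 0\<close> on a set of \<open>k\<close> coordinates and \<open>b < 0\<close> on the
  others. They are feasible by direct computation, and two distinct values can always be matched by
  the two multipliers, so they are stationary.

  For \<open>k = 1\<close> the point is even a global maximum. By Cauchy-Schwarz no coordinate of a feasible
  vector exceeds \<open>sqrt ((n - 1) / n)\<close>, which is exactly \<open>a\<close>. On the half-line up to \<open>a\<close> the odd
  power \<open>t ^ m\<close> lies below the quadratic \<open>q\<close> that touches it at \<open>b\<close> and meets it at \<open>a\<close>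
  (\<open>odd_power_le_quadratic\<close>). The sum of \<open>q\<close> over the coordinates is the same for all feasible
  vectors, because both the sum and the sum of squares of the coordinates are prescribed. Hence it
  bounds the objective everywhere, and the bound is attained at a vector whose coordinates all lie in
  \<open>{a, b}\<close> (\<open>objective_le_two_valued\<close>).

  For \<open>k \<ge> 2\<close> the largest value is attained at two coordinates, which excludes a local
  maximum (\<open>not_local_max_of_repeated_maximum\<close>): raising one of the two coordinates and lowering the
  other is a direction tangent to the feasible set, and rotating \<open>u\<close> towards it leaves the objective
  unchanged to first order and increases it to second order. The sign of the second variation comes
  from the fact that the objective is a weighted mean, with weights \<open>u\<^sub>i\<^sup>2\<close>, of the numbers \<open>u\<^sub>i ^ (m - 2)\<close>, hence is at most the largest
  of them, while the second variation compares it with \<open>m - 1\<close> times the largest. Since the objective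
  is odd, the smallest value, attained \<open>n - k \<ge> 2\<close> times, likewise excludes a local minimum.
\<close>

section \<open>The feasible set and two-valued points\<close>

lemma feasible_set_iff:
  "(u :: real^'n) \<in> feasible_set \<longleftrightarrow> (\<Sum>i\<in>UNIV. (u $ i)\<^sup>2) = 1 \<and> (\<Sum>i\<in>UNIV. u $ i) = 0"
  by (simp add: feasible_set_def inner_vec_def power2_eq_square)

lemma sum_two_valued:
  fixes u :: "real^'n" and g :: "real \<Rightarrow> real"
  assumes "\<And>i. u $ i = (if i \<in> A then a else b)"
  shows "(\<Sum>i\<in>UNIV. g (u $ i)) = real (card A) * g a + (real CARD('n) - real (card A)) * g b"
proof -
  have "(\<Sum>i\<in>UNIV. g (u $ i)) = (\<Sum>i\<in>UNIV. if i \<in> A then g a else g b)"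
    by (intro sum.cong) (auto simp: assms)
  also have "\<dots> = (\<Sum>i\<in>A. g a) + (\<Sum>i\<in>-A. g b)"
    by (subst sum.If_cases) auto
  also have "\<dots> = real (card A) * g a + real (card (-A)) * g b"
    by simp
  also have "real (card (-A)) = real CARD('n) - real (card A)"
    by (simp add: Compl_eq_Diff_UNIV card_Diff_subset of_nat_diff card_mono)
  finally show ?thesis .
qed

lemma permuted_block_vec_two_valued:
  fixes P :: "real^'n^'n"
  assumes e: "bij_betw e {1..CARD('n)} UNIV" and k: "k \<le> CARD('n)"
    and P: "permutation_matrix P"
  obtains A where "card A = k"
    and "\<And>i. (P *v block_vec e k a b) $ i = (if i \<in> A then a else b)"
proof -
  from P obtain p where p: "p permutes UNIV" and P': "P = (\<chi> i j. if j = p i then 1 else 0)"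
    unfolding permutation_matrix_def by blast
  define A where "A = p -` (e ` {1..k})"
  have "inj_on e {1..k}"
    using e k by (auto simp: bij_betw_def intro: inj_on_subset)
  then have "card (e ` {1..k}) = k"
    by (simp add: card_image)
  moreover have "card A = card (e ` {1..k})"
    unfolding A_def using p by (intro card_vimage_inj) (auto simp: permutes_inj permutes_surj)
  ultimately have "card A = k" by simp
  moreover have "(P *v block_vec e k a b) $ i = (if i \<in> A then a else b)" for i
  proof -
    have "(P *v block_vec e k a b) $ i
        = (\<Sum>j\<in>UNIV. if j = p i then block_vec e k a b $ j else 0)"
      by (simp add: P' matrix_vector_mult_def if_distrib [of "\<lambda>y. y * _"] cong: if_cong)
    also have "\<dots> = block_vec e k a b $ p i"
      by simp
    finally show ?thesis by (simp add: block_vec_def A_def)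
  qed
  ultimately show ?thesis by (rule that)
qed

lemma stationary_point_two_valued:
  fixes u :: "real^'n"
  assumes u: "u \<in> feasible_set" and val: "\<And>i. u $ i \<in> {a, b}" and "a \<noteq> b"
  shows "stationary_point m u"
proof -
  define \<alpha> where "\<alpha> = (a ^ (m - 1) - b ^ (m - 1)) / (a - b)"
  define \<beta> where "\<beta> = a ^ (m - 1) - \<alpha> * a"
  have "\<alpha> * (a - b) = a ^ (m - 1) - b ^ (m - 1)"
    using \<open>a \<noteq> b\<close> by (simp add: \<alpha>_def)
  then have "b ^ (m - 1) - \<alpha> * b - \<beta> = 0"
    by (simp add: \<beta>_def algebra_simps)
  then have "(u $ i) ^ (m - 1) - \<alpha> * u $ i - \<beta> = 0" for i
    using val[of i] by (auto simp: \<beta>_def)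
  then show ?thesis
    using u unfolding stationary_point_def by blast
qed

section \<open>One coordinate as large as possible: a global maximum\<close>

text \<open>
  The other coordinates sum to \<open>- v $ i\<close> and their squares sum to \<open>1 - (v $ i)\<^sup>2\<close>, so Cauchy-Schwarz
  applied to them limits \<open>v $ i\<close>.
\<close>
lemma feasible_coordinate_le:
  fixes v :: "real^'n"
  assumes "v \<in> feasible_set"
  shows "v $ i \<le> sqrt ((real CARD('n) - 1) / real CARD('n))"
proof -
  let ?n = "real CARD('n)"
  have sq: "(\<Sum>j\<in>UNIV-{i}. (v $ j)\<^sup>2) = 1 - (v $ i)\<^sup>2" and su: "(\<Sum>j\<in>UNIV-{i}. v $ j) = - v $ i"
    using assms unfolding feasible_set_iff by (auto simp: sum_diff1)
  have "(\<Sum>j\<in>UNIV-{i}. v $ j)\<^sup>2 \<le> (\<Sum>j\<in>UNIV-{i}. (v $ j)\<^sup>2) * card (UNIV-{i})"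
    using sum_squared_le_sum_of_squares[of "\<lambda>j. v $ j" "UNIV-{i}"] by (simp add: mult.commute)
  moreover have "real (card (UNIV-{i})) = ?n - 1"
    by (simp add: card_Diff_singleton of_nat_diff Suc_leI)
  ultimately have "(v $ i)\<^sup>2 \<le> (1 - (v $ i)\<^sup>2) * (?n - 1)"
    by (simp add: sq su)
  then have "?n * (v $ i)\<^sup>2 \<le> ?n - 1"
    by (simp add: algebra_simps)
  then have "(v $ i)\<^sup>2 \<le> (?n - 1) / ?n"
    by (simp add: field_simps)
  then show ?thesis
    by (rule real_le_rsqrt)
qed

text \<open>
  The difference \<open>g\<close> of the two sides has a double zero at \<open>b\<close>, a zero at \<open>a\<close>, and an increasing
  second derivative, because \<open>m - 2\<close> is odd. The zeros force the second derivative to vanish at some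
  \<open>\<xi>\<close> between \<open>b\<close> and \<open>a\<close>. So \<open>g\<close> is concave to the left of \<open>\<xi>\<close>, where it stays below its
  tangent at \<open>b\<close>, the zero line; and it is convex to the right, where it stays below the larger of its
  values at \<open>\<xi>\<close> and \<open>a\<close>.
\<close>
lemma odd_power_le_quadratic:
  fixes a b c t :: real
  assumes m: "m \<ge> 3" "odd m" and "b < a" and "t \<le> a"
    and c: "a ^ m = b ^ m + real m * b ^ (m - 1) * (a - b) + c * (a - b)\<^sup>2"
  shows "t ^ m \<le> b ^ m + real m * b ^ (m - 1) * (t - b) + c * (t - b)\<^sup>2"
proof -
  define g where "g x = x ^ m - (b ^ m + real m * b ^ (m - 1) * (x - b) + c * (x - b)\<^sup>2)" for x
  define g' where "g' x = real m * x ^ (m - 1) - real m * b ^ (m - 1) - 2 * c * (x - b)" for x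
  define g'' where "g'' x = real m * (real m - 1) * x ^ (m - 2) - 2 * c" for x
  have g0: "g b = 0" "g' b = 0" "g a = 0"
    using c by (auto simp: g_def g'_def)
  have dg: "(g has_real_derivative g' x) (at x)" for x
    unfolding g_def g'_def by (auto intro!: derivative_eq_intros)
  have dg': "(g' has_real_derivative g'' x) (at x)" for x
    unfolding g'_def g''_def using m
    by (auto intro!: derivative_eq_intros simp: of_nat_diff numeral_2_eq_2)
  have mono: "g'' x \<le> g'' y" if "x \<le> y" for x y
    using m that unfolding g''_def
    by (auto intro!: mult_left_mono power_mono_odd simp: even_diff_nat)
  have taylor: "\<exists>\<xi>. min b x < \<xi> \<and> \<xi> < max b x \<and> g x = g'' \<xi> / 2 * (x - b)\<^sup>2" if "x \<noteq> b" for x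
  proof -
    define d where "d k = (if k = 0 then g else if k = 1 then g' else g'')" for k :: nat
    have "\<exists>\<xi>. (if x < b then x < \<xi> \<and> \<xi> < b else b < \<xi> \<and> \<xi> < x) \<and>
        g x = (\<Sum>k<2. d k b / fact k * (x - b) ^ k) + d 2 \<xi> / fact 2 * (x - b) ^ 2"
    proof (rule Taylor)
      show "\<forall>k t. k < 2 \<and> min b x \<le> t \<and> t \<le> max b x \<longrightarrow> (d k has_real_derivative d (Suc k) t) (at t)"
        by (auto simp: d_def less_Suc_eq numeral_2_eq_2 dg dg')
    qed (use that in \<open>auto simp: d_def\<close>)
    then show ?thesis
      by (auto simp: d_def g0 numeral_2_eq_2 lessThan_Suc split: if_splits)
  qed
  obtain \<xi> where \<xi>: "b < \<xi>" "\<xi> < a" and "g a = g'' \<xi> / 2 * (a - b)\<^sup>2"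
    using taylor[of a] \<open>b < a\<close> by auto
  then have zero: "g'' \<xi> = 0"
    using g0 \<open>b < a\<close> by simp
  have left: "g x \<le> 0" if "x \<le> \<xi>" for x
  proof (cases "x = b")
    case False
    then obtain \<eta> where "\<eta> < max b x" and gx: "g x = g'' \<eta> / 2 * (x - b)\<^sup>2"
      using taylor by blast
    then have "g'' \<eta> / 2 \<le> 0"
      using mono[of \<eta> \<xi>] zero that \<xi> by auto
    then show ?thesis
      unfolding gx by (intro mult_nonpos_nonneg) auto
  qed (simp add: g0)
  have "g t \<le> 0"
  proof (cases "t \<le> \<xi>")
    case False
    have "convex_on {\<xi>..a} g"
      by (rule f''_ge0_imp_convex[OF _ dg dg']) (use mono[of \<xi>] zero in auto)
    then have "g t \<le> max (g \<xi>) (g a)"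
      by (rule convex_on_le_max) (use False \<open>t \<le> a\<close> \<xi> in auto)
    then show ?thesis
      using left[of \<xi>] g0 by simp
  qed (rule left)
  then show ?thesis by (simp add: g_def)
qed

text \<open>
  The comparison works because the quadratic majorant \<open>q\<close> has the same total on all
  feasible vectors, and the power agrees with \<open>q\<close> at the values taken by \<open>u\<close>.
\<close>
lemma objective_le_two_valued:
  fixes u v :: "real^'n"
  assumes m: "m \<ge> 3" "odd m" and uv: "u \<in> feasible_set" "v \<in> feasible_set"
    and val: "\<And>i. u $ i \<in> {a, b}" and "b < a" and le: "\<And>i. v $ i \<le> a"
  shows "objective m v \<le> objective m u"
proof -
  define c where "c = (a ^ m - b ^ m - real m * b ^ (m - 1) * (a - b)) / (a - b)\<^sup>2"
  define q where "q t = b ^ m + real m * b ^ (m - 1) * (t - b) + c * (t - b)\<^sup>2" for t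
  have qa: "a ^ m = q a" and qb: "b ^ m = q b"
    using \<open>b < a\<close> by (auto simp: q_def c_def)
  \<comment> \<open>The linear term of \<open>q\<close> contributes a multiple of the coordinate sum \<open>0\<close>, the quadratic term a
    multiple of the sum of squares \<open>1\<close>.\<close>
  have expand: "(\<Sum>i\<in>UNIV. q (z $ i)) = real CARD('n) * q 0 + c" if "z \<in> feasible_set" for z :: "real^'n"
  proof -
    have "q t = q 0 + (real m * b ^ (m - 1) - 2 * c * b) * t + c * t\<^sup>2" for t
      by (simp add: q_def power2_eq_square algebra_simps)
    then have "(\<Sum>i\<in>UNIV. q (z $ i)) = (\<Sum>i\<in>UNIV.
        q 0 + (real m * b ^ (m - 1) - 2 * c * b) * z $ i + c * (z $ i)\<^sup>2)"
      by (intro sum.cong refl)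
    also have "\<dots> = real CARD('n) * q 0
        + (real m * b ^ (m - 1) - 2 * c * b) * (\<Sum>i\<in>UNIV. z $ i) + c * (\<Sum>i\<in>UNIV. (z $ i)\<^sup>2)"
      by (simp add: sum.distrib sum_distrib_left)
    finally show ?thesis
      using that by (simp add: feasible_set_iff)
  qed
  have "objective m v \<le> (\<Sum>i\<in>UNIV. q (v $ i))"
    unfolding objective_def q_def
    by (intro sum_mono odd_power_le_quadratic[OF m \<open>b < a\<close> le qa[unfolded q_def]])
  also have "\<dots> = (\<Sum>i\<in>UNIV. q (u $ i))"
    by (simp add: expand uv)
  also have "\<dots> = objective m u"
  proof -
    have "q (u $ i) = (u $ i) ^ m" for i
      using val[of i] qa qb by auto
    then show ?thesis
      by (simp add: objective_def)
  qed
  finally show ?thesis .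
qed

section \<open>A repeated largest coordinate: no local maximum\<close>

lemma increase_of_second_derivative_pos:
  fixes \<phi> \<phi>' :: "real \<Rightarrow> real"
  assumes d: "\<And>t. (\<phi> has_real_derivative \<phi>' t) (at t)"
    and d0: "\<phi>' 0 = 0" and d2: "(\<phi>' has_real_derivative D) (at 0)" and "D > 0" and "\<epsilon> > 0"
  shows "\<exists>t. 0 < t \<and> t < \<epsilon> \<and> \<phi> 0 < \<phi> t"
proof -
  obtain \<delta> where \<delta>: "\<delta> > 0" "\<And>h. 0 < h \<Longrightarrow> h < \<delta> \<Longrightarrow> 0 < \<phi>' h"
    using DERIV_pos_inc_right[OF d2 \<open>D > 0\<close>] d0 by auto
  define t where "t = min \<delta> \<epsilon> / 2"
  have t: "0 < t" "t < \<delta>" "t < \<epsilon>"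
    using \<delta>(1) \<open>\<epsilon> > 0\<close> by (auto simp: t_def min_def)
  obtain z where "0 < z" "z < t" "\<phi> t - \<phi> 0 = (t - 0) * \<phi>' z"
    using MVT2[of 0 t \<phi> \<phi>'] t d by blast
  then have "\<phi> 0 < \<phi> t"
    using \<delta>(2)[of z] t by (smt (verit) mult_pos_pos)
  then show ?thesis using t by blast
qed

text \<open>
  An orthonormal pair \<open>u\<close>, \<open>w\<close> of feasible vectors spans a great circle \<open>cos t u + sin t w\<close> lying
  entirely in the feasible set. Along it the
  objective has second derivative \<open>m\<close> times the difference of the two sides of \<open>second\<close> at \<open>t = 0\<close>;
  the term \<open>- objective m u\<close> is the effect of the curve bending towards \<open>- u\<close>.
\<close>
lemma not_local_max_of_second_variation:
  fixes u w :: "real^'n"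
  assumes "m \<ge> 2" and u: "u \<in> feasible_set" and w: "w \<in> feasible_set" and orth: "u \<bullet> w = 0"
    and first: "(\<Sum>i\<in>UNIV. (u $ i) ^ (m - 1) * w $ i) = 0"
    and second: "objective m u < (real m - 1) * (\<Sum>i\<in>UNIV. (u $ i) ^ (m - 2) * (w $ i)\<^sup>2)"
  shows "\<not> local_max_on feasible_set (objective m) u"
proof
  assume "local_max_on feasible_set (objective m) u"
  then obtain \<epsilon> where \<epsilon>: "\<epsilon> > 0"
    "\<And>v. v \<in> feasible_set \<Longrightarrow> dist v u < \<epsilon> \<Longrightarrow> objective m v \<le> objective m u"
    unfolding local_max_on_def by blast
  define v where "v t = cos t *\<^sub>R u + sin t *\<^sub>R w" for t
  have "v t \<in> feasible_set" for t
    using u w orth by (simp add: v_def feasible_set_def inner_add inner_commute[of w u]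
        flip: power2_eq_square)
  have v0: "v 0 = u"
    by (simp add: v_def)
  have "isCont v 0"
    unfolding v_def by (intro continuous_intros)
  then obtain \<delta> where \<delta>: "\<delta> > 0" "\<And>t. \<bar>t\<bar> < \<delta> \<Longrightarrow> dist (v t) u < \<epsilon>"
    using \<epsilon>(1) unfolding continuous_at_eps_delta v0 by (auto simp: dist_norm)
  define x where "x t i = cos t * u $ i + sin t * w $ i" for t i
  define x' where "x' t i = - sin t * u $ i + cos t * w $ i" for t i
  have dx: "((\<lambda>t. x t i) has_real_derivative x' t i) (at t)" for t i
    unfolding x_def x'_def by (auto intro!: derivative_eq_intros)
  have dx': "((\<lambda>t. x' t i) has_real_derivative - x t i) (at t)" for t i
    unfolding x_def x'_def by (auto intro!: derivative_eq_intros)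
  have obj: "objective m (v t) = (\<Sum>i\<in>UNIV. x t i ^ m)" for t
    by (simp add: objective_def v_def x_def)
  define \<phi>' where "\<phi>' t = (\<Sum>i\<in>UNIV. real m * (x t i ^ (m - 1) * x' t i))" for t
  have d1: "((\<lambda>t. objective m (v t)) has_real_derivative \<phi>' t) (at t)" for t
    unfolding obj \<phi>'_def by (auto intro!: derivative_eq_intros dx sum.cong)
  have "(\<phi>' has_real_derivative (\<Sum>i\<in>UNIV. real m *
      (real (m - 1) * x 0 i ^ (m - 1 - 1) * x' 0 i * x' 0 i + x 0 i ^ (m - 1) * (- x 0 i)))) (at 0)"
    unfolding \<phi>'_def by (auto intro!: derivative_eq_intros dx dx' sum.cong simp: algebra_simps)
  also have "(\<Sum>i\<in>UNIV. real m *
      (real (m - 1) * x 0 i ^ (m - 1 - 1) * x' 0 i * x' 0 i + x 0 i ^ (m - 1) * (- x 0 i)))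
    = (\<Sum>i\<in>UNIV. real m * ((real m - 1) * ((u $ i) ^ (m - 2) * (w $ i)\<^sup>2) - (u $ i) ^ m))"
    using \<open>m \<ge> 2\<close>
    by (intro sum.cong) (auto simp: x_def x'_def of_nat_diff power2_eq_square numeral_2_eq_2
        simp flip: power_Suc2)
  also have "\<dots> = real m * ((real m - 1) * (\<Sum>i\<in>UNIV. (u $ i) ^ (m - 2) * (w $ i)\<^sup>2) - objective m u)"
    by (simp add: objective_def sum_subtractf flip: sum_distrib_left)
  finally have d2: "(\<phi>' has_real_derivative \<dots>) (at 0)" .
  have "\<phi>' 0 = 0"
    using first by (simp add: \<phi>'_def x_def x'_def flip: sum_distrib_left)
  moreover have "0 < real m * ((real m - 1) * (\<Sum>i\<in>UNIV. (u $ i) ^ (m - 2) * (w $ i)\<^sup>2) - objective m u)"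
    using second \<open>m \<ge> 2\<close> by simp
  ultimately obtain t where "0 < t" "t < \<delta>" "objective m (v 0) < objective m (v t)"
    using increase_of_second_derivative_pos[OF d1 _ d2 _ \<delta>(1)] by blast
  then show False
    using \<epsilon>(2)[of "v t"] \<delta>(2)[of t] \<open>v t \<in> feasible_set\<close> v0 by auto
qed

text \<open>
  In the direction that raises one of the two largest coordinates and lowers the other, the first-order
  effects cancel, and the second variation is positive because \<open>objective m u \<le> x ^ (m - 2)\<close> while
  \<open>m - 1 \<ge> 2\<close> and \<open>x > 0\<close>.
\<close>
lemma not_local_max_of_repeated_maximum:
  fixes u :: "real^'n"
  assumes m: "m \<ge> 3" "odd m" and u: "u \<in> feasible_set"
    and "i \<noteq> j" and eq: "u $ i = x" "u $ j = x" and le: "\<And>l. u $ l \<le> x" and "x > 0"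
  shows "\<not> local_max_on feasible_set (objective m) u"
proof -
  \<comment> \<open>The tangent direction of the exchange; the factor makes \<open>w\<close> a unit vector.\<close>
  define w :: "real^'n" where "w = (1 / sqrt 2) *\<^sub>R (axis i 1 - axis j 1)"
  have w: "w $ l = (if l = i then 1 / sqrt 2 else 0) - (if l = j then 1 / sqrt 2 else 0)" for l
    by (simp add: w_def axis_def)
  have w2: "(w $ l)\<^sup>2 = (if l = i then 1 / 2 else 0) + (if l = j then 1 / 2 else 0)" for l
    using \<open>i \<noteq> j\<close> by (simp add: w power_divide)
  have wfeas: "w \<in> feasible_set"
  proof -
    have "(\<Sum>l\<in>UNIV. w $ l) = 0"
      unfolding w by (simp add: sum_subtractf)
    moreover have "(\<Sum>l\<in>UNIV. (w $ l)\<^sup>2) = 1"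
      unfolding w2 by (simp add: sum.distrib)
    ultimately show ?thesis
      by (simp add: feasible_set_iff)
  qed
  have sum_w: "(\<Sum>l\<in>UNIV. g (u $ l) * w $ l) = 0" for g :: "real \<Rightarrow> real"
  proof -
    have "g (u $ l) * w $ l = (if l = i then g x / sqrt 2 else 0) - (if l = j then g x / sqrt 2 else 0)"
      for l
      by (simp add: w eq)
    then show ?thesis
      by (simp add: sum_subtractf)
  qed
  have sum_w2: "(\<Sum>l\<in>UNIV. (u $ l) ^ (m - 2) * (w $ l)\<^sup>2) = x ^ (m - 2)"
  proof -
    have "(u $ l) ^ (m - 2) * (w $ l)\<^sup>2
        = (if l = i then x ^ (m - 2) / 2 else 0) + (if l = j then x ^ (m - 2) / 2 else 0)" for l
      by (simp add: w2 eq)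
    then show ?thesis
      by (simp add: sum.distrib)
  qed
  \<comment> \<open>The weights \<open>(u $ l)\<^sup>2\<close> sum to one, so the objective is a mean of the \<open>(u $ l) ^ (m - 2)\<close>; as
    \<open>m - 2\<close> is odd, negative coordinates obey the same bound.\<close>
  have "objective m u = (\<Sum>l\<in>UNIV. (u $ l)\<^sup>2 * (u $ l) ^ (m - 2))"
  proof -
    have "m = 2 + (m - 2)"
      using m by simp
    then show ?thesis
      unfolding objective_def by (metis power_add)
  qed
  also have "\<dots> \<le> (\<Sum>l\<in>UNIV. (u $ l)\<^sup>2 * x ^ (m - 2))"
    using m le by (intro sum_mono mult_left_mono power_mono_odd) auto
  also have "\<dots> = x ^ (m - 2)"
    using u by (simp add: feasible_set_iff flip: sum_distrib_right)
  also have "\<dots> < (real m - 1) * x ^ (m - 2)"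
    using m \<open>x > 0\<close> by simp
  finally show ?thesis
    using m sum_w[of "\<lambda>t. t"] sum_w[of "\<lambda>t. t ^ (m - 1)"] sum_w2
    by (intro not_local_max_of_second_variation[OF _ u wfeas]) (auto simp: inner_vec_def)
qed

lemma local_min_iff_local_max_uminus:
  fixes u :: "real^'n"
  assumes "odd m"
  shows "local_min_on feasible_set (objective m) u
    \<longleftrightarrow> local_max_on feasible_set (objective m) (- u)"
proof -
  have obj: "objective m (- v) = - objective m v" for v :: "real^'n"
    using assms by (simp add: objective_def sum_negf)
  have feas: "- v \<in> feasible_set \<longleftrightarrow> v \<in> feasible_set" for v :: "real^'n"
    by (simp add: feasible_set_def)
  have dist: "dist (- v) (- u) = dist v u" for v
    by (simp add: dist_norm norm_minus_commute)
  have all: "(\<forall>v::real^'n. Q v) \<longleftrightarrow> (\<forall>v. Q (- v))" for Q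
    by (metis minus_minus)
  show ?thesis
    unfolding local_min_on_def local_max_on_def Ball_def
    by (subst (2) all) (simp only: obj feas dist neg_le_iff_le)
qed

section \<open>Classification of the two-valued points\<close>

lemma two_elements_of_card_ge_2:
  assumes "2 \<le> card S"
  shows "\<exists>i\<in>S. \<exists>j\<in>S. i \<noteq> j"
proof -
  obtain T where "T \<subseteq> S" "card T = 2"
    using obtain_subset_with_card_n[OF assms] by blast
  then show ?thesis
    unfolding card_2_iff by blast
qed

theorem lemma3:
  fixes n m k :: nat and e :: "nat \<Rightarrow> 'n::finite"
    and P :: "real^'n^'n" and a b :: real and u :: "real^'n"
  assumes "n = CARD('n)" and "n \<ge> 3"
    and "m \<ge> 3" and "odd m"
    and "1 \<le> k" and "k \<le> n div 2"
    and "bij_betw e {1..n} UNIV"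
    and "permutation_matrix P"
    and "a = sqrt ((real n - real k) / (real k * real n))"
    and "b = - sqrt (real k / ((real n - real k) * real n))"
    and "u = P *v block_vec e k a b"
  shows "stationary_point m u \<and>
    (k = 1 \<longrightarrow> local_max_on feasible_set (objective m) u) \<and>
    (2 \<le> k \<longrightarrow> saddle_point m u)"
proof -
  have kn: "0 < real k" "0 < real n - real k" "0 < real n" "k \<le> n" "2 * k \<le> n"
    using assms by auto
  have ab: "b < 0" "0 < a"
    using kn assms by auto
  obtain A where cardA: "card A = k" and u: "\<And>i. u $ i = (if i \<in> A then a else b)"
    using permuted_block_vec_two_valued[of e k P a b] assms kn by auto
  have val: "u $ i \<in> {a, b}" for i
    by (simp add: u)
  have a2: "a\<^sup>2 = (real n - real k) / (real k * real n)"
    and b2: "b\<^sup>2 = real k / ((real n - real k) * real n)"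
    using kn assms by auto
  have "real k * a\<^sup>2 + (real n - real k) * b\<^sup>2 = 1"
    unfolding a2 b2 using kn by (simp add: field_simps)
  moreover have "real k * a + (real n - real k) * b = 0"
  proof -
    have "(real k * a)\<^sup>2 = ((real n - real k) * - b)\<^sup>2"
      unfolding power_mult_distrib power2_minus a2 b2 using kn by (simp add: field_simps power2_eq_square)
    then have "real k * a = (real n - real k) * - b"
      by (rule power2_eq_imp_eq) (use kn ab in \<open>auto intro: mult_nonneg_nonpos\<close>)
    then show ?thesis by simp
  qed
  ultimately have feas: "u \<in> feasible_set"
    using sum_two_valued[OF u, where g = "\<lambda>t. t\<^sup>2"] sum_two_valued[OF u, where g = "\<lambda>t. t"]
    by (simp add: feasible_set_iff cardA assms(1))
  have stat: "stationary_point m u"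
    using stationary_point_two_valued[OF feas val] ab by simp
  have "local_max_on feasible_set (objective m) u" if "k = 1"
  proof -
    have "v $ i \<le> a" if "v \<in> feasible_set" for v :: "real^'n" and i
      using feasible_coordinate_le[OF that] assms \<open>k = 1\<close> by simp
    then have "objective m v \<le> objective m u" if "v \<in> feasible_set" for v :: "real^'n"
      using objective_le_two_valued[OF assms(3,4) feas that val] ab that by auto
    then show ?thesis
      using feas unfolding local_max_on_def by (auto intro: exI[of _ 1])
  qed
  moreover have "saddle_point m u" if k2: "2 \<le> k"
  proof -
    obtain i j where "i \<in> A" "j \<in> A" "i \<noteq> j"
      using two_elements_of_card_ge_2[of A] cardA k2 by blast
    then have "\<not> local_max_on feasible_set (objective m) u"
      using ab assms(3,4) feas u by (intro not_local_max_of_repeated_maximum[of m u i j a]) auto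
    moreover have "\<not> local_min_on feasible_set (objective m) u"
    proof -
      have "card (- A) = n - k"
        using cardA assms(1) by (simp add: Compl_eq_Diff_UNIV card_Diff_subset)
      then have "2 \<le> card (- A)"
        using kn k2 by linarith
      then obtain i j where "i \<in> - A" "j \<in> - A" "i \<noteq> j"
        using two_elements_of_card_ge_2[of "- A"] by blast
      moreover have "- u \<in> feasible_set"
        using feas by (simp add: feasible_set_def)
      ultimately have "\<not> local_max_on feasible_set (objective m) (- u)"
        using ab assms(3,4) u by (intro not_local_max_of_repeated_maximum[of m "- u" i j "- b"]) auto
      then show ?thesis
        by (simp add: local_min_iff_local_max_uminus assms(4))
    qed
    ultimately show ?thesis
      using stat by (simp add: saddle_point_def)
  qed
  ultimately show ?thesis
    using stat by blast
qed

end
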